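(* Let $d\ge 2$ and let $S^{d-1}$ be the unit sphere in $\mathbb{R}^d$. (i) Let $\delta\in[0,\frac14)$, let $f:S^{d-1}\to\mathbb{R}^d$ be a continuous map that satisfies $\|f(x)-f(y)\|\ge\|x-y\|-\delta$ for all $x,y\in S^{d-1}$, and let $\Sigma:=f(S^{d-1})$. Then $\Sigma$ has a hole containing a ball of radius $\frac14$. (ii) Let $\delta\in[0,\frac14)$ and let $f_1,f_2:S^{d-1}\to\mathbb{R}^d$ be continuous maps satisfying $\|f_i(x)-f_i(y)\|\ge\|x-y\|-\delta$ for all $x,y\in S^{d-1}$, $i=1,2$, and suppose that, moreover, $\|f_1(x)-f_2(x)\|<\frac14$ for all $x\in S^{d-1}$. Then some hole of $\Sigma_1:=f_1(S^{d-1})$ intersects some hole of $\Sigma_2:=f_2(S^{d-1})$. (iii) Let $\delta$, $f$, and $\Sigma$ satisfy the hypotheses of (i), and assume that, moreover, $f$ is $D$-Lipschitz for some $D\ge1$. Then there is at most one hole of $\Sigma$ containing a ball of radius $4D\delta$.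
   Context: $\|\cdot\|$ is the Euclidean norm. For a compact set $K\subset\mathbb{R}^d$, a hole of $K$ is a bounded connected component of $\mathbb{R}^d\setminus K$. Balls are closed Euclidean balls. *)

theory Defs
  imports "HOL-Analysis.Analysis"
begin

(* Used only for compact K, but the definition itself needs no compactness. *)
definition holes :: "'a::euclidean_space set \<Rightarrow> 'a set set" where
  "holes K = {H \<in> components (- K). bounded H}"

end

theory Submission
  imports Defs "HOL-Homology.Homology"
begin

text \<open>
  The preimage of a small ball under \<open>f\<close> has diameter little more than \<open>\<delta>\<close>, so averaging over
  preimages yields a continuous approximate left inverse \<open>g\<close> of \<open>f\<close> on a neighbourhood of the image
  \<open>\<Sigma>\<close>. Within distance \<open>1/4\<close> of \<open>\<Sigma>\<close> the map \<open>g\<close> does not vanish.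

  For (i) and (ii), the normalised \<open>g\<close> extends to a sphere-valued map \<open>G\<close> defined off finitely many
  points, all of them in holes of \<open>\<Sigma>\<close> and at distance more than \<open>1/4\<close> from \<open>\<Sigma>\<close>, with \<open>G \<circ> f\<close>
  homotopic to the identity of the sphere. If there were no such points, \<open>G\<close> would be defined on \<open>\<Sigma>\<close>
  together with its holes; this compact set does not separate space, so Borsuk's theorem would make
  \<open>G \<circ> f\<close> null-homotopic. In (ii) none of these points lies on the linear homotopy from \<open>f1\<close> to
  \<open>f2\<close>, so \<open>G \<circ> f2\<close> is essential too, and by the same argument one of the points is in a hole of
  the second image.

  For (iii), suppose that \<open>a\<close> and \<open>b\<close> are centres of such balls in two different holes. Each of the two
  holes provides a cycle of dimension \<open>d - 1\<close> near \<open>\<Sigma>\<close> that links one of the points but not the other.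
  The Lipschitz bound makes \<open>f \<circ> g\<close> homotopic to the inclusion in the complement of either point, so
  the two linking homomorphisms factor through the infinite cyclic group \<open>H\<^bsub>d-1\<^esub>(S\<^bsup>d-1\<^esup>)\<close>, which
  is impossible for two independent classes.
\<close>

section \<open>Filling in the holes of a compact set\<close>

lemma compact_union_inside:
  fixes S :: "'a::euclidean_space set"
  assumes "compact S"
  shows "compact (S \<union> inside S)"
proof -
  have "closed (S \<union> inside S)"
    using open_outside [OF compact_imp_closed [OF assms]] by (simp add: union_with_inside closed_Compl)
  moreover have "bounded (S \<union> inside S)"
    using assms by (simp add: bounded_inside compact_imp_bounded)
  ultimately show ?thesis
    by (simp add: compact_eq_bounded_closed)
qed

lemma hole_of_inside:
  assumes "x \<in> inside K"
  shows "connected_component_set (- K) x \<in> holes K" "x \<in> connected_component_set (- K) x"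
  using assms by (auto simp: holes_def inside_def componentsI)

section \<open>Continuous approximate left inverses\<close>

text \<open>\<open>g\<close> averages finitely many points of \<open>X\<close> by a partition of
  unity subordinate to the \<open>\<sigma>\<close>-balls about their images. Points with positive
  weight at \<open>y\<close> have images within \<open>\<sigma>\<close> of \<open>y\<close>, so the
  expansion bound puts them within \<open>\<sigma> + \<delta> + dist y (f x)\<close> of
  \<open>x\<close>, and so is their average.\<close>

lemma approximate_inverse:
  fixes f :: "'a::euclidean_space \<Rightarrow> 'b::euclidean_space"
  assumes X: "compact X" "X \<noteq> {}" and f: "continuous_on X f"
    and exp: "\<And>x y. \<lbrakk>x \<in> X; y \<in> X\<rbrakk> \<Longrightarrow> norm (f x - f y) \<ge> norm (x - y) - \<delta>"
    and \<rho>: "0 < \<rho>" "\<rho> < \<sigma>"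
  obtains g where "continuous_on {y. infdist y (f ` X) \<le> \<rho>} g"
    "\<And>x y. \<lbrakk>x \<in> X; infdist y (f ` X) \<le> \<rho>\<rbrakk> \<Longrightarrow> norm (g y - x) \<le> \<sigma> + \<delta> + dist y (f x)"
proof -
  let ?T = "{y. infdist y (f ` X) \<le> \<rho>}"
  have cfX: "compact (f ` X)"
    using X(1) f compact_continuous_image by blast
  then have "compact ?T"
    using X \<rho> by (intro compact_infdist_le) auto
  \<comment> \<open>The gap \<open>\<rho> < \<sigma>\<close> lets open \<open>\<sigma>\<close>-balls
    cover the closed \<open>\<rho>\<close>-neighbourhood.\<close>
  moreover have "?T \<subseteq> (\<Union>x\<in>X. ball (f x) \<sigma>)"
  proof
    fix y assume "y \<in> ?T"
    moreover obtain v where "v \<in> f ` X" "infdist y (f ` X) = dist y v"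
      using infdist_attains_inf [of "f ` X" y] cfX X by (auto simp: compact_imp_closed)
    ultimately show "y \<in> (\<Union>x\<in>X. ball (f x) \<sigma>)"
      using \<rho> by (force simp: dist_commute)
  qed
  ultimately obtain F where F: "F \<subseteq> X" "finite F" "?T \<subseteq> (\<Union>x\<in>F. ball (f x) \<sigma>)"
    using compactE_image [of ?T X "\<lambda>x. ball (f x) \<sigma>"] by auto
  define \<phi> where "\<phi> = (\<lambda>x y. max 0 (\<sigma> - dist y (f x)))"
  define \<Phi> where "\<Phi> = (\<lambda>y. \<Sum>x\<in>F. \<phi> x y)"
  define g where "g = (\<lambda>y. \<Sum>x\<in>F. (\<phi> x y / \<Phi> y) *\<^sub>R x)"
  have \<phi>0: "\<phi> x y \<ge> 0" for x y
    by (simp add: \<phi>_def)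
  have pos: "\<Phi> y > 0" if y: "y \<in> ?T" for y
  proof -
    obtain x where "x \<in> F" "y \<in> ball (f x) \<sigma>"
      using F(3) y by blast
    then have "\<phi> x y > 0"
      by (simp add: \<phi>_def dist_commute)
    then show ?thesis
      unfolding \<Phi>_def using \<open>x \<in> F\<close> F(2) \<phi>0 by (intro sum_pos2)
  qed
  show ?thesis
  proof
    have "continuous_on ?T \<Phi>"
      unfolding \<Phi>_def \<phi>_def by (intro continuous_intros)
    moreover have "continuous_on ?T (\<phi> x)" for x
      unfolding \<phi>_def by (intro continuous_intros)
    ultimately show "continuous_on ?T g"
      unfolding g_def using pos by (intro continuous_intros) (auto simp: less_imp_neq [symmetric] dest: pos)
  next
    fix x y assume x: "x \<in> X" and "infdist y (f ` X) \<le> \<rho>"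
    then have \<Phi>y: "\<Phi> y > 0"
      using pos by simp
    have one: "(\<Sum>z\<in>F. \<phi> z y / \<Phi> y) = 1"
      using \<Phi>y by (simp add: \<Phi>_def flip: sum_divide_distrib)
    have "g y - x = (\<Sum>z\<in>F. (\<phi> z y / \<Phi> y) *\<^sub>R (z - x))"
      using one by (simp add: g_def scaleR_diff_right sum_subtractf flip: scaleR_sum_left)
    also have "norm \<dots> \<le> (\<Sum>z\<in>F. (\<phi> z y / \<Phi> y) * (\<sigma> + \<delta> + dist y (f x)))"
    proof (rule sum_norm_le)
      fix z assume z: "z \<in> F"
      show "norm ((\<phi> z y / \<Phi> y) *\<^sub>R (z - x)) \<le> (\<phi> z y / \<Phi> y) * (\<sigma> + \<delta> + dist y (f x))"
      proof (cases "dist y (f z) < \<sigma>")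
        case True
        have "norm (z - x) \<le> dist (f z) (f x) + \<delta>"
          using exp [of z x] x z F(1) by (auto simp: dist_norm)
        also have "\<dots> \<le> \<sigma> + \<delta> + dist y (f x)"
          using True dist_triangle [of "f z" "f x" y] by (simp add: dist_commute)
        finally show ?thesis
          using \<Phi>y \<phi>0 [of z y] by (simp add: mult_left_mono divide_right_mono)
      qed (simp add: \<phi>_def)
    qed
    also have "\<dots> = \<sigma> + \<delta> + dist y (f x)"
      using one by (metis (no_types) mult_1 sum_distrib_right)
    finally show "norm (g y - x) \<le> \<sigma> + \<delta> + dist y (f x)" .
  qed
qed

text \<open>Normalising moves \<open>v\<close> by the difference of \<open>norm v\<close> and
  \<open>norm x\<close>, hence by at most \<open>norm (v - x)\<close>; the triangle inequality
  doubles the error.\<close>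

lemma sgn_approximates_unit_vector:
  fixes v x :: "'a::real_inner"
  assumes "norm x = 1" "v \<noteq> 0"
  shows "norm (sgn v - x) \<le> 2 * norm (v - x)"
proof -
  have "sgn v - v = (1 - norm v) *\<^sub>R sgn v"
    using assms(2) by (simp add: sgn_div_norm algebra_simps)
  then have "norm (sgn v - v) = \<bar>norm x - norm v\<bar>"
    using assms by (simp add: norm_sgn)
  also have "\<dots> \<le> norm (v - x)"
    by (metis norm_minus_commute norm_triangle_ineq3)
  finally show ?thesis
    using norm_triangle_ineq [of "sgn v - v" "v - x"] by simp
qed

lemma sphere_left_inverse_off_deep_points:
  fixes f :: "'a::euclidean_space \<Rightarrow> 'a"
  defines "S \<equiv> sphere (0::'a) 1"
  assumes dim: "2 \<le> DIM('a)" and \<delta>: "\<delta> < 1/4" and f: "continuous_on S f"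
    and exp: "\<And>x y. \<lbrakk>x \<in> S; y \<in> S\<rbrakk> \<Longrightarrow> norm (f x - f y) \<ge> norm (x - y) - \<delta>"
  obtains C G where "C \<subseteq> inside (f ` S)" "\<And>c. c \<in> C \<Longrightarrow> 1/4 < infdist c (f ` S)"
    "continuous_on (- C) G" "G \<in> (- C) \<rightarrow> S"
    "homotopic_with_canon (\<lambda>_. True) S S (G \<circ> f) id"
proof -
  let ?\<Sigma> = "f ` S"
  \<comment> \<open>At distance at most \<open>1/4\<close> from the image, the error of
    \<open>g\<close> against a nearest \<open>f x\<close> is at most
    \<open>1/2 + \<eta> + \<delta> < 1 = norm x\<close>, so \<open>g\<close> cannot vanish
    there.\<close>
  define \<eta> where "\<eta> = (1/4 - \<delta>) / 2"
  have \<eta>: "\<eta> > 0" "3/4 + \<eta> + \<delta> < 1"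
    using \<delta> by (simp_all add: \<eta>_def field_simps)
  have S: "compact S" "S \<noteq> {}"
    by (auto simp: S_def)
  then have \<Sigma>: "compact ?\<Sigma>" "?\<Sigma> \<noteq> {}"
    using f compact_continuous_image by blast+
  let ?T = "{y. infdist y ?\<Sigma> \<le> 1/4}"
  obtain g where contg: "continuous_on ?T g"
    and g: "\<And>x y. \<lbrakk>x \<in> S; infdist y ?\<Sigma> \<le> 1/4\<rbrakk> \<Longrightarrow> norm (g y - x) \<le> (1/4 + \<eta>) + \<delta> + dist y (f x)"
    using approximate_inverse [OF S f exp, of "1/4" "1/4 + \<eta>"] \<eta> by auto
  have g0: "g y \<noteq> 0" if "y \<in> ?T" for y
  proof
    assume "g y = 0"
    obtain x where "x \<in> S" "infdist y ?\<Sigma> = dist y (f x)"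
      using infdist_attains_inf [of ?\<Sigma> y] \<Sigma> by (auto simp: compact_imp_closed)
    then show False
      using g [of x y] that \<open>g y = 0\<close> \<eta> by (simp add: S_def)
  qed
  \<comment> \<open>Extending a sphere-valued map from a compact set requires a point to delete in
    each bounded component of \<open>- K\<close>. Restricting the filled image to \<open>?T\<close>
    allows all these points to be taken in \<open>inside ?\<Sigma> - ?T\<close>.\<close>
  define K where "K = (?\<Sigma> \<union> inside ?\<Sigma>) \<inter> ?T"
  have "compact K"
    unfolding K_def using \<Sigma> by (intro compact_Int compact_union_inside compact_infdist_le) auto
  moreover have "continuous_on K (\<lambda>y. sgn (g y))"
    using g0 by (intro continuous_on_sgn continuous_on_subset [OF contg]) (auto simp: K_def)
  moreover have "(\<lambda>y. sgn (g y)) \<in> K \<rightarrow> sphere 0 1"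
    using g0 by (auto simp: K_def norm_sgn)
  moreover have "C \<inter> (inside ?\<Sigma> - ?T) \<noteq> {}" if C: "C \<in> components (- K)" "bounded C" for C
  proof
    \<comment> \<open>A bounded component without such points would meet, hence contain, the
      connected set \<open>outside ?\<Sigma>\<close>, which is unbounded.\<close>
    assume "C \<inter> (inside ?\<Sigma> - ?T) = {}"
    moreover have "- K = outside ?\<Sigma> \<union> (inside ?\<Sigma> - ?T)"
    proof -
      have "infdist y ?\<Sigma> = 0" if "y \<in> ?\<Sigma>" for y
        using that by simp
      then have "?\<Sigma> \<subseteq> ?T"
        by fastforce
      then show ?thesis
        using union_with_inside [of ?\<Sigma>] unfolding K_def by blast
    qed
    ultimately have "C \<inter> outside ?\<Sigma> \<noteq> {}" "outside ?\<Sigma> \<subseteq> - K"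
      using in_components_nonempty [OF C(1)] in_components_subset [OF C(1)] by auto
    then have "outside ?\<Sigma> \<subseteq> C"
      using connected_outside [OF compact_imp_bounded dim] \<Sigma>(1) components_maximal [OF C(1)] by blast
    then show False
      using unbounded_outside [OF compact_imp_bounded [OF \<Sigma>(1)]] C(2) bounded_subset by blast
  qed
  ultimately obtain C G where C: "C \<subseteq> inside ?\<Sigma> - ?T" and G: "continuous_on (- C) G" "G \<in> (- C) \<rightarrow> sphere 0 1"
    and Gg: "\<And>y. y \<in> K \<Longrightarrow> G y = sgn (g y)"
    using extend_map_UNIV_to_sphere_cofinite [of 1 K "\<lambda>y. sgn (g y)" 0 "inside ?\<Sigma> - ?T"]
    by (metis (no_types, lifting) order_refl zero_le_one)
  have fC: "f \<in> S \<rightarrow> - C"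
    using C inside_no_overlap [of ?\<Sigma>] by blast
  have fT: "f ` S \<subseteq> ?T"
    using infdist_zero by force
  \<comment> \<open>Since \<open>g (f x)\<close> is at distance less than 1 from the unit vector
    \<open>x\<close>, the segment between them misses the origin, and the linear homotopy can be
    normalised.\<close>
  have "homotopic_with_canon (\<lambda>_. True) S (- {0}) (g \<circ> f) id"
  proof (rule homotopic_with_linear)
    show "continuous_on S (g \<circ> f)"
      using f contg fT by (intro continuous_on_compose) (auto intro: continuous_on_subset)
    fix x assume x: "x \<in> S"
    have "norm (g (f x) - x) < 1"
      using g [OF x, of "f x"] x \<eta> \<delta> by simp
    then have "0 \<notin> closed_segment (g (f x)) x"
      using segment_bound(2) [of 0 "g (f x)" x] x by (auto simp: S_def norm_minus_commute)
    then show "closed_segment ((g \<circ> f) x) (id x) \<subseteq> - {0}"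
      by auto
  qed auto
  then have "homotopic_with_canon (\<lambda>_. True) S S (sgn \<circ> (g \<circ> f)) (sgn \<circ> id)"
    by (rule homotopic_with_compose_continuous_left) (auto simp: S_def norm_sgn intro!: continuous_on_sgn)
  then have "homotopic_with_canon (\<lambda>_. True) S S (G \<circ> f) id"
  proof (rule homotopic_with_eq)
    show "(G \<circ> f) x = (sgn \<circ> (g \<circ> f)) x" if "x \<in> topspace (top_of_set S)" for x
      using that fT Gg [of "f x"] by (auto simp: K_def)
    show "id x = (sgn \<circ> id) x" if "x \<in> topspace (top_of_set S)" for x
      using that by (simp add: S_def sgn_div_norm)
  qed auto
  then show ?thesis
    using that [of C G] C G by (force simp: S_def)
qed

section \<open>Essential maps and the location of holes\<close>

text \<open>The filled image is compact with connected complement, so Borsuk's theorem makes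
  \<open>G\<close> null-homotopic on it. A homotopy from \<open>G \<circ> f\<close> to
  \<open>id\<close> would then contract the sphere.\<close>

lemma sphere_map_extending_over_inside_not_homotopic_id:
  fixes f G :: "'a::euclidean_space \<Rightarrow> 'a"
  defines "S \<equiv> sphere (0::'a) 1"
  assumes dim: "2 \<le> DIM('a)" and f: "continuous_on S f"
    and G: "continuous_on (f ` S \<union> inside (f ` S)) G" "G \<in> (f ` S \<union> inside (f ` S)) \<rightarrow> S"
  shows "\<not> homotopic_with_canon (\<lambda>_. True) S S (G \<circ> f) id"
proof
  assume id: "homotopic_with_canon (\<lambda>_. True) S S (G \<circ> f) id"
  let ?Z = "f ` S \<union> inside (f ` S)"
  have "compact (f ` S)"
    using f by (auto simp: S_def intro: compact_continuous_image)
  then have "compact ?Z" "connected (- ?Z)"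
    using dim compact_union_inside connected_outside [of "f ` S"]
    by (auto simp: union_with_inside compact_imp_bounded)
  then obtain c where "homotopic_with_canon (\<lambda>_. True) ?Z S G (\<lambda>_. c)"
    using G Borsuk_separation_theorem [OF _ dim, of ?Z] unfolding S_def by blast
  then have "homotopic_with_canon (\<lambda>_. True) S S (G \<circ> f) ((\<lambda>_. c) \<circ> f)"
    using f by (intro homotopic_with_compose_continuous_right) auto
  then have "homotopic_with_canon (\<lambda>_. True) S S (G \<circ> f) (\<lambda>_. c)"
    by (simp add: o_def)
  then have "homotopic_with_canon (\<lambda>_. True) S S id (\<lambda>_. c)"
    by (rule homotopic_with_trans [OF homotopic_with_symD [OF id]])
  then have "contractible S"
    by (auto simp: contractible_def)
  then show False
    by (simp add: S_def contractible_sphere)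
qed

text \<open>Any deleted point can serve as centre; if there were none, \<open>G\<close> would extend
  over the filled image.\<close>

lemma hole_with_quarter_ball:
  fixes f :: "'a::euclidean_space \<Rightarrow> 'a"
  defines "S \<equiv> sphere (0::'a) 1"
  assumes dim: "2 \<le> DIM('a)" and \<delta>: "\<delta> < 1/4" and f: "continuous_on S f"
    and exp: "\<And>x y. \<lbrakk>x \<in> S; y \<in> S\<rbrakk> \<Longrightarrow> norm (f x - f y) \<ge> norm (x - y) - \<delta>"
  shows "\<exists>H\<in>holes (f ` S). \<exists>c. cball c (1/4) \<subseteq> H"
proof -
  obtain C G where C: "C \<subseteq> inside (f ` S)" "\<And>c. c \<in> C \<Longrightarrow> 1/4 < infdist c (f ` S)"
    and G: "continuous_on (- C) G" "G \<in> (- C) \<rightarrow> S"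
      "homotopic_with_canon (\<lambda>_. True) S S (G \<circ> f) id"
    using sphere_left_inverse_off_deep_points [OF dim \<delta>] f exp unfolding S_def by blast
  have "C \<noteq> {}"
  proof
    assume "C = {}"
    then have "\<not> homotopic_with_canon (\<lambda>_. True) S S (G \<circ> f) id"
      using sphere_map_extending_over_inside_not_homotopic_id [OF dim, of f G] f G(1,2)
      unfolding S_def by (auto intro: continuous_on_subset)
    then show False
      using G(3) by simp
  qed
  then obtain c where c: "c \<in> inside (f ` S)" "1/4 < infdist c (f ` S)"
    using C by blast
  have "cball c (1/4) \<subseteq> connected_component_set (- f ` S) c"
  proof (rule connected_component_maximal)
    show "cball c (1/4) \<subseteq> - f ` S"
    proof
      fix y assume "y \<in> cball c (1/4)"
      then show "y \<in> - f ` S"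
        using c(2) infdist_le [of y "f ` S" c] by force
    qed
  qed auto
  then show ?thesis
    using hole_of_inside(1) [OF c(1)] by blast
qed

text \<open>The left inverse \<open>G\<close> of \<open>f1\<close> up to homotopy is one of
  \<open>f2\<close> as well, so some deleted point lies inside the image of \<open>f2\<close>. By
  construction it also lies inside the image of \<open>f1\<close>.\<close>

lemma holes_of_close_maps_intersect:
  fixes f1 f2 :: "'a::euclidean_space \<Rightarrow> 'a"
  defines "S \<equiv> sphere (0::'a) 1"
  assumes dim: "2 \<le> DIM('a)" and \<delta>: "\<delta> < 1/4"
    and f1: "continuous_on S f1" and f2: "continuous_on S f2"
    and exp: "\<And>x y. \<lbrakk>x \<in> S; y \<in> S\<rbrakk> \<Longrightarrow> norm (f1 x - f1 y) \<ge> norm (x - y) - \<delta>"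
    and close: "\<And>x. x \<in> S \<Longrightarrow> norm (f1 x - f2 x) < 1/4"
  shows "\<exists>H1\<in>holes (f1 ` S). \<exists>H2\<in>holes (f2 ` S). H1 \<inter> H2 \<noteq> {}"
proof -
  obtain C G where C: "C \<subseteq> inside (f1 ` S)" "\<And>c. c \<in> C \<Longrightarrow> 1/4 < infdist c (f1 ` S)"
    and G: "continuous_on (- C) G" "G \<in> (- C) \<rightarrow> S"
      "homotopic_with_canon (\<lambda>_. True) S S (G \<circ> f1) id"
    using sphere_left_inverse_off_deep_points [OF dim \<delta>] f1 exp unfolding S_def by blast
  \<comment> \<open>The segment stays within \<open>1/4\<close> of \<open>f1 x\<close>, while points
    of \<open>C\<close> are farther than that from the first image.\<close>
  have seg: "closed_segment (f1 x) (f2 x) \<subseteq> - C" if x: "x \<in> S" for x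
  proof
    fix y assume "y \<in> closed_segment (f1 x) (f2 x)"
    then have "dist y (f1 x) \<le> dist (f1 x) (f2 x)"
      using segment_bound(1) by (metis dist_norm dist_commute)
    then have "infdist y (f1 ` S) \<le> 1/4"
      using close [OF x] infdist_le [of "f1 x" "f1 ` S" y] x by (simp add: dist_norm)
    then show "y \<in> - C"
      using C(2) by force
  qed
  have "homotopic_with_canon (\<lambda>_. True) S (- C) f1 f2"
    using f1 f2 seg by (rule homotopic_with_linear)
  then have "homotopic_with_canon (\<lambda>_. True) S S (G \<circ> f1) (G \<circ> f2)"
    using G by (intro homotopic_with_compose_continuous_left) auto
  then have id: "homotopic_with_canon (\<lambda>_. True) S S (G \<circ> f2) id"
    using G(3) by (metis homotopic_with_symD homotopic_with_trans)
  have "\<not> f2 ` S \<union> inside (f2 ` S) \<subseteq> - C"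
  proof
    assume "f2 ` S \<union> inside (f2 ` S) \<subseteq> - C"
    then have "\<not> homotopic_with_canon (\<lambda>_. True) S S (G \<circ> f2) id"
      using f2 G(1,2) unfolding S_def
      by (intro sphere_map_extending_over_inside_not_homotopic_id [OF dim] continuous_on_subset [OF G(1)]) (auto simp: S_def)
    then show False
      using id by simp
  qed
  moreover have "f2 ` S \<subseteq> - C"
    using seg by auto
  ultimately obtain c where c: "c \<in> inside (f1 ` S)" "c \<in> inside (f2 ` S)"
    using C(1) by blast
  show ?thesis
  proof (intro bexI)
    show "connected_component_set (- f1 ` S) c \<inter> connected_component_set (- f2 ` S) c \<noteq> {}"
      using hole_of_inside(2) [OF c(1)] hole_of_inside(2) [OF c(2)] by blast
  qed (use hole_of_inside(1) c in blast)+
qed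

section \<open>Linking cycles\<close>

lemma homology_group_euclidean_sphere:
  assumes "2 \<le> DIM('a::euclidean_space)" "0 < r"
  shows "homology_group (int (DIM('a) - 1)) (top_of_set (sphere (0::'a) r)) \<cong> integer_group"
proof -
  let ?n = "DIM('a) - 1"
  obtain f :: "(nat \<Rightarrow> real) \<Rightarrow> 'a" and g
    where "homeomorphic_maps (nsphere ?n) (top_of_set (sphere 0 1 \<inter> span Basis)) f g"
    by (rule homeomorphic_maps_nsphere_euclidean_sphere
        [OF independent_Basis orthogonal_Basis refl _ norm_Basis]) auto
  then have "nsphere ?n homeomorphic_space top_of_set (sphere (0::'a) 1)"
    by (auto simp: homeomorphic_space_def)
  moreover have "top_of_set (sphere (0::'a) 1) homeomorphic_space top_of_set (sphere (0::'a) r)"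
    using assms by (simp add: homeomorphic_spheres)
  ultimately have "nsphere ?n homeomorphic_space top_of_set (sphere (0::'a) r)"
    using homeomorphic_space_trans by blast
  then have "homology_group ?n (nsphere ?n) \<cong> homology_group ?n (top_of_set (sphere (0::'a) r))"
    by (rule homeomorphic_space_imp_isomorphic_homology_groups)
  \<comment> \<open>The degree is at least 1, where reduced and ordinary homology agree.\<close>
  moreover have "homology_group ?n (nsphere ?n) \<cong> integer_group"
    using reduced_homology_group_nsphere(1) [of ?n] assms
    by (simp add: un_reduced_homology_group)
  ultimately show ?thesis
    by (meson group.iso_sym group_relative_homology_group iso_trans)
qed

lemma homology_group_punctured_space:
  assumes "2 \<le> DIM('a::euclidean_space)"
  shows "homology_group (int (DIM('a) - 1)) (top_of_set (- {a::'a})) \<cong> integer_group"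
proof -
  have "sphere a 1 homotopy_eqv - {a}"
    using homotopy_eqv_rel_frontier_punctured_affine_hull [of "cball a 1" a]
    by (simp add: rel_interior_nonempty_interior affine_hull_nonempty_interior Compl_eq_Diff_UNIV)
  moreover have "sphere (0::'a) 1 homotopy_eqv sphere a 1"
    by (intro homeomorphic_imp_homotopy_eqv homeomorphic_spheres) auto
  ultimately have "sphere (0::'a) 1 homotopy_eqv - {a}"
    using homotopy_eqv_trans by blast
  then show ?thesis
    using homology_group_euclidean_sphere [OF assms, of 1]
    by (meson group.iso_sym group_relative_homology_group
        homotopy_equivalent_space_imp_isomorphic_homology_groups iso_trans zero_less_one)
qed

text \<open>Torsion-freeness of the integers, pulled back along the isomorphism.\<close>

lemma infinite_cyclic_int_pow_eq_one:
  assumes "group G" "G \<cong> integer_group" "x \<in> carrier G" "x \<noteq> \<one>\<^bsub>G\<^esub>" "x [^]\<^bsub>G\<^esub> (k::int) = \<one>\<^bsub>G\<^esub>"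
  shows "k = 0"
proof -
  obtain h where h: "h \<in> iso G integer_group"
    using assms(2) by (auto simp: is_iso_def)
  interpret group_hom G integer_group h
    using h assms(1) by (simp add: group_hom_def group_hom_axioms_def iso_def)
  have "inj_on h (carrier G)"
    using h by (simp add: iso_def bij_betw_def)
  then have "h x \<noteq> 0"
    using assms by (metis G.one_closed hom_one inj_onD one_integer_group)
  moreover have "k * h x = 0"
    using hom_int_pow [OF assms(3), of k] assms(5) hom_one by (simp add: mult.commute)
  ultimately show ?thesis
    by simp
qed

text \<open>
  The big sphere around \<open>A - N\<close> bounds a relative class of the whole space modulo the complement of
  \<open>A - N\<close>; excision moves this class to \<open>(A \<union> N, N)\<close>, and its boundary is the required cycle.
\<close>

lemma linking_cycle:
  fixes a b :: "'a::euclidean_space"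
  defines "p \<equiv> int (DIM('a) - 1)"
  assumes dim: "2 \<le> DIM('a)"
    and "open N" "open (A \<union> N)" "compact (A - N)"
    and a: "a \<in> A" "a \<notin> N" and b: "b \<notin> A" "b \<notin> N"
  obtains z where "z \<in> carrier (homology_group p (top_of_set N))"
    "hom_induced p (top_of_set N) {} (top_of_set (- {a})) {} id z \<noteq> \<one>\<^bsub>homology_group p (top_of_set (- {a}))\<^esub>"
    "hom_induced p (top_of_set N) {} (top_of_set (- {b})) {} id z = \<one>\<^bsub>homology_group p (top_of_set (- {b}))\<^esub>"
proof -
  let ?H = "\<lambda>S::'a set. homology_group p (top_of_set S)"
  let ?i = "\<lambda>S T::'a set. hom_induced p (top_of_set S) {} (top_of_set T) {} id"
  have incl: "?i T W (?i S T x) = ?i S W x" if "S \<subseteq> T" "T \<subseteq> W" for S T W :: "'a set" and x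
    using that by (subst hom_induced_compose') (auto simp: continuous_map_in_subtopology)
  define C where "C = A - N"
  define V where "V = A \<union> N"
  have p: "p \<noteq> 0"
    using dim by (simp add: p_def)
  obtain R where R: "R > 0" "C \<subseteq> ball 0 R"
    using assms(5) bounded_subset_ballD[OF compact_imp_bounded, of "A - N" 0] C_def by blast
  let ?S = "sphere (0::'a) R"
  have "\<not> trivial_group (?H ?S)"
    using homology_group_euclidean_sphere [OF dim \<open>R > 0\<close>]
    by (metis p_def group_integer_group group_relative_homology_group isomorphic_group_triviality nontrivial_integer_group)
  then obtain s where s: "s \<in> carrier (?H ?S)" "s \<noteq> \<one>\<^bsub>?H ?S\<^esub>"
    using group.is_monoid [OF group_relative_homology_group, THEN monoid.one_closed, of p "top_of_set ?S" "{}"]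
    by (simp add: trivial_group_def) blast
  have sC: "?S \<subseteq> - C" and aC: "- C \<subseteq> - {a}"
    using R a by (auto simp: C_def)
  \<comment> \<open>The enclosing sphere is a retract of \<open>- {a}\<close>, so its nontrivial
    class survives there.\<close>
  have sa: "?i ?S (- {a}) s \<noteq> \<one>\<^bsub>?H (- {a})\<^esub>"
  proof
    assume eq: "?i ?S (- {a}) s = \<one>\<^bsub>?H (- {a})\<^esub>"
    have "a \<in> ball 0 R"
      using a R by (auto simp: C_def)
    then obtain r where r: "retraction (- {a}) ?S r"
      using sphere_retract_of_punctured_universe_gen retract_of_def by blast
    let ?r = "hom_induced p (top_of_set (- {a})) {} (top_of_set ?S) {} r"
    have "?r (?i ?S (- {a}) s) = hom_induced p (top_of_set ?S) {} (top_of_set ?S) {} (r \<circ> id) s"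
      using r sC aC by (subst hom_induced_compose') (auto simp: retraction_def continuous_map_in_subtopology Pi_iff image_subset_iff)
    also have "\<dots> = s"
      using r s(1) by (intro hom_induced_id_gen) (auto simp: retraction_def continuous_map_in_subtopology intro: continuous_on_subset)
    finally have "s = ?r \<one>\<^bsub>?H (- {a})\<^esub>"
      using eq by simp
    also have "\<dots> = \<one>\<^bsub>?H ?S\<^esub>"
      using hom_induced_hom by (rule hom_one) auto
    finally show False
      using s by simp
  qed
  define u where "u = ?i ?S (- C) s"
  have u: "u \<in> carrier (?H (- C))"
    unfolding u_def by (rule hom_induced_carrier)
  \<comment> \<open>Contractibility kills \<open>u\<close> in the whole space; exactness then makes
    it the boundary of a relative class \<open>\<mu>\<close>.\<close>
  have "contractible_space (euclidean :: 'a topology)"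
    using contractible_space_top_of_set[of "UNIV :: 'a set"] contractible_UNIV by simp
  then have "trivial_group (homology_group p (euclidean :: 'a topology))"
    using trivial_reduced_homology_group_contractible_space [of _ p] p by (simp add: un_reduced_homology_group)
  then have "hom_induced p (top_of_set (- C)) {} (euclidean :: 'a topology) {} id u = \<one>\<^bsub>homology_group p (euclidean :: 'a topology)\<^esub>"
    using hom_induced_carrier by (fastforce simp: trivial_group_def)
  then have "u \<in> hom_boundary (p+1) euclidean (- C) ` carrier (relative_homology_group (p+1) euclidean (- C))"
    using homology_exactness_axiom_2 [of "p+1" "euclidean :: 'a topology" "- C"] u
    by (auto simp: kernel_def)
  then obtain \<mu> where \<mu>: "\<mu> \<in> carrier (relative_homology_group (p+1) euclidean (- C))" "hom_boundary (p+1) euclidean (- C) \<mu> = u"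
    by blast
  \<comment> \<open>Excising \<open>- V\<close> leaves the pair \<open>(V, N)\<close>. This is
    permitted because \<open>- V\<close> is closed, \<open>- C\<close> is open and
    \<open>C \<subseteq> V\<close>.\<close>
  have N: "- C \<inter> V = N" "V \<inter> N = N" "UNIV - (- V) = V"
    by (auto simp: C_def V_def)
  have "closed C" "open V"
    using assms by (auto simp: C_def V_def compact_imp_closed)
  then have "euclidean closure_of (- V) \<subseteq> euclidean interior_of (- C)"
    by (simp add: open_Compl closed_Compl interior_open closure_closed) (auto simp: C_def V_def)
  then have "hom_induced (p+1) (top_of_set V) N euclidean (- C) id
     \<in> iso (relative_homology_group (p+1) (top_of_set V) N) (relative_homology_group (p+1) euclidean (- C))"
    using homology_excision_axiom [of euclidean "- V" "- C" UNIV "p+1"] by (simp add: N)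
  then obtain \<zeta> where \<zeta>: "\<zeta> \<in> carrier (relative_homology_group (p+1) (top_of_set V) N)"
     "hom_induced (p+1) (top_of_set V) N euclidean (- C) id \<zeta> = \<mu>"
    using \<mu>(1) by (metis (no_types, lifting) iso_iff imageE)
  define z where "z = hom_boundary (p+1) (top_of_set V) N \<zeta>"
  have sub: "subtopology (top_of_set V) N = top_of_set N"
    using N(2) by (simp add: subtopology_subtopology)
  have z: "z \<in> carrier (?H N)"
    using hom_boundary_carrier [of "p+1" "top_of_set V" N \<zeta>] by (simp add: z_def sub)
  have NC: "N \<subseteq> - C" and NV: "N \<subseteq> V" and Vb: "V \<subseteq> - {b}"
    using b by (auto simp: C_def V_def)
  \<comment> \<open>By naturality of the boundary, \<open>z\<close> and \<open>s\<close> agree in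
    the homology of \<open>- C\<close>, hence also off \<open>a\<close>.\<close>
  from NC have "id \<in> N \<rightarrow> - C"
    by auto
  then have "?i N (- C) z = u"
    using fun_cong [OF naturality_hom_induced [of "top_of_set V" euclidean id N "- C" "p+1"], of \<zeta>]
    by (simp add: z_def sub \<mu> \<zeta>)
  then have "?i N (- {a}) z = ?i ?S (- {a}) s"
    using incl NC sC aC u_def by metis
  \<comment> \<open>As the boundary of a class of \<open>(V, N)\<close>, \<open>z\<close> dies in
    \<open>V\<close>, and \<open>V\<close> avoids \<open>b\<close>.\<close>
  moreover have "?i N V z = \<one>\<^bsub>?H V\<^esub>"
    using homology_exactness_axiom_2 [of "p+1" "top_of_set V" "N"] \<zeta>(1)
    by (auto simp: kernel_def z_def sub)
  then have "?i N (- {b}) z = ?i V (- {b}) \<one>\<^bsub>?H V\<^esub>"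
    using incl [OF NV Vb] by metis
  moreover have "\<dots> = \<one>\<^bsub>?H (- {b})\<^esub>"
    using hom_induced_hom by (rule hom_one) auto
  ultimately show ?thesis
    using sa z by (intro that [of z]) auto
qed


text \<open>\<open>A\<close> and \<open>B\<close> model two holes, \<open>N\<close> a neighbourhood
  of the image. The holes supply classes \<open>z\<close> and \<open>w\<close>, each nontrivial off
  just one of \<open>a\<close>, \<open>b\<close>, whereas their images under \<open>h\<close> are
  powers of a single generator.\<close>

lemma no_factorization_through_sphere:
  fixes a b :: "'a::euclidean_space"
  assumes dim: "2 \<le> DIM('a)"
    and N: "open N" "a \<notin> N" "b \<notin> N"
    and A: "open (A \<union> N)" "compact (A - N)" "a \<in> A" "b \<notin> A"
    and B: "open (B \<union> N)" "compact (B - N)" "b \<in> B" "a \<notin> B"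
    and h: "continuous_on N h" "h \<in> N \<rightarrow> sphere 0 1"
    and f: "continuous_on (sphere (0::'a) 1) f" "f \<in> sphere 0 1 \<rightarrow> - {a, b}"
    and hom: "\<And>c. c \<in> {a, b} \<Longrightarrow> homotopic_with_canon (\<lambda>_. True) N (- {c}) (f \<circ> h) id"
  shows False
proof -
  define p where "p = int (DIM('a) - 1)"
  let ?H = "\<lambda>S::'a set. homology_group p (top_of_set S)"
  let ?i = "\<lambda>S T::'a set. hom_induced p (top_of_set S) {} (top_of_set T) {} id"
  let ?f = "\<lambda>c. hom_induced p (top_of_set (sphere 0 1)) {} (top_of_set (- {c})) {} f"
  let ?h = "hom_induced p (top_of_set N) {} (top_of_set (sphere 0 1)) {} h"
  obtain z where z: "z \<in> carrier (?H N)" "?i N (- {a}) z \<noteq> \<one>\<^bsub>?H (- {a})\<^esub>" "?i N (- {b}) z = \<one>\<^bsub>?H (- {b})\<^esub>"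
    using linking_cycle [OF dim N(1) A(1,2,3) N(2) A(4) N(3)] unfolding p_def by blast
  obtain w where w: "w \<in> carrier (?H N)" "?i N (- {b}) w \<noteq> \<one>\<^bsub>?H (- {b})\<^esub>" "?i N (- {a}) w = \<one>\<^bsub>?H (- {a})\<^esub>"
    using linking_cycle [OF dim N(1) B(1,2,3) N(3) B(4) N(2)] unfolding p_def by blast
  have fh: "?f c (?h x) = ?i N (- {c}) x" if "c \<in> {a, b}" for c x
  proof -
    have "hom_induced p (top_of_set N) {} (top_of_set (- {c})) {} (f \<circ> h) = ?i N (- {c})"
      using hom [OF that] by (rule homology_homotopy_empty)
    moreover have "f \<in> sphere 0 1 \<rightarrow> - {c}"
      using f that by auto
    ultimately show ?thesis
      using h f by (subst hom_induced_compose') (auto simp: continuous_map_in_subtopology image_subset_iff)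
  qed
  have iso: "?H (sphere 0 1) \<cong> integer_group"
    using homology_group_euclidean_sphere [OF dim, of 1] by (simp add: p_def)
  then have "cyclic_group (?H (sphere 0 1))"
    using cyclic_integer_group group_integer_group group_relative_homology_group isomorphic_group_cyclicity by blast
  then obtain s where s: "s \<in> carrier (?H (sphere 0 1))" "carrier (?H (sphere 0 1)) = range (\<lambda>n::int. s [^]\<^bsub>?H (sphere 0 1)\<^esub> n)"
    by (auto simp: group.cyclic_group)
  have fpow: "?f c (s [^]\<^bsub>?H (sphere 0 1)\<^esub> n) = ?f c s [^]\<^bsub>?H (- {c})\<^esub> n" for c and n :: int
    by (rule hom_int_pow [OF hom_induced_hom s(1)]) auto
  have fs: "?f c s \<in> carrier (?H (- {c}))" for c
    by (rule hom_induced_carrier)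
  have hpow: "?h x \<in> range (\<lambda>n::int. s [^]\<^bsub>?H (sphere 0 1)\<^esub> n)" for x
    unfolding s(2) [symmetric] by (rule hom_induced_carrier)
  obtain m :: int where m: "?h z = s [^]\<^bsub>?H (sphere 0 1)\<^esub> m"
    using rangeE [OF hpow [of z]] .
  obtain n :: int where n: "?h w = s [^]\<^bsub>?H (sphere 0 1)\<^esub> n"
    using rangeE [OF hpow [of w]] .
  have 1: "?f a s [^]\<^bsub>?H (- {a})\<^esub> m \<noteq> \<one>\<^bsub>?H (- {a})\<^esub>" "?f b s [^]\<^bsub>?H (- {b})\<^esub> m = \<one>\<^bsub>?H (- {b})\<^esub>"
    using z fh [of a z] fh [of b z] fpow [of a m] fpow [of b m] m by auto
  have 2: "?f b s [^]\<^bsub>?H (- {b})\<^esub> n \<noteq> \<one>\<^bsub>?H (- {b})\<^esub>"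
    using w fh [of b w] fpow [of b n] n by auto
  \<comment> \<open>The image of the generator off \<open>b\<close> has a nontrivial
    \<open>n\<close>-th power, so it is nontrivial itself. Its \<open>m\<close>-th power is trivial,
    so \<open>m = 0\<close>, contradicting nontriviality of the \<open>m\<close>-th power off
    \<open>a\<close>.\<close>
  have "?f b s \<noteq> \<one>\<^bsub>?H (- {b})\<^esub>"
    using 2 group.int_pow_one [OF group_relative_homology_group] by metis
  moreover have "?H (- {b}) \<cong> integer_group"
    unfolding p_def by (rule homology_group_punctured_space [OF dim])
  ultimately have "m = 0"
    by (rule infinite_cyclic_int_pow_eq_one [OF group_relative_homology_group _ fs _ 1(2), rotated])
  show False
    using 1(1) unfolding \<open>m = 0\<close> by (simp add: int_pow_def2)
qed

section \<open>Uniqueness of the hole with a large ball\<close>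

text \<open>Sending a point near the image to the sphere by normalised \<open>g\<close> and back by
  \<open>f\<close> moves it by at most \<open>2 * D * \<delta>\<close> plus an arbitrarily small
  error. Balls of radius \<open>4 * D * \<delta>\<close> keep \<open>a\<close> and \<open>b\<close>
  off this motion.\<close>

lemma holes_with_large_balls_eq:
  fixes f :: "'a::euclidean_space \<Rightarrow> 'a"
  defines "S \<equiv> sphere (0::'a) 1"
  assumes dim: "2 \<le> DIM('a)" and \<delta>: "0 \<le> \<delta>" "\<delta> < 1/4"
    and exp: "\<And>x y. \<lbrakk>x \<in> S; y \<in> S\<rbrakk> \<Longrightarrow> norm (f x - f y) \<ge> norm (x - y) - \<delta>"
    and D: "1 \<le> D" "D-lipschitz_on S f"
    and A: "A \<in> holes (f ` S)" "cball a (4 * D * \<delta>) \<subseteq> A"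
    and B: "B \<in> holes (f ` S)" "cball b (4 * D * \<delta>) \<subseteq> B"
  shows "A = B"
proof (rule ccontr)
  assume "A \<noteq> B"
  let ?\<Sigma> = "f ` S"
  have f: "continuous_on S f"
    using D(2) by (rule lipschitz_on_continuous_on)
  have S: "compact S" "S \<noteq> {}"
    by (auto simp: S_def)
  then have \<Sigma>: "compact ?\<Sigma>" "?\<Sigma> \<noteq> {}"
    using f compact_continuous_image by blast+
  have D\<delta>: "0 \<le> D * \<delta>"
    using D(1) \<delta>(1) by simp
  then have ab: "a \<in> A" "b \<in> B"
    using A(2) B(2) by auto
  have disj: "A \<inter> B = {}"
    using A(1) B(1) \<open>A \<noteq> B\<close> components_eq by (auto simp: holes_def)
  have attain: "\<exists>x\<in>S. infdist y ?\<Sigma> = dist y (f x)" for y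
    using infdist_attains_inf [of ?\<Sigma> y] \<Sigma> by (auto simp: compact_imp_closed)
  have far: "4 * D * \<delta> < infdist c ?\<Sigma>" if "H \<in> holes ?\<Sigma>" "cball c (4 * D * \<delta>) \<subseteq> H" for c H
  proof -
    obtain x where "x \<in> S" "infdist c ?\<Sigma> = dist c (f x)"
      using attain by blast
    moreover have "H \<subseteq> - ?\<Sigma>"
      using that(1) in_components_subset by (auto simp: holes_def)
    ultimately have "f x \<notin> cball c (4 * D * \<delta>)"
      using that(2) by blast
    then show ?thesis
      using \<open>infdist c ?\<Sigma> = dist c (f x)\<close> by simp
  qed
  define m where "m = min (infdist a ?\<Sigma>) (infdist b ?\<Sigma>)"
  have m: "4 * D * \<delta> < m"
    using far [OF A] far [OF B] by (simp add: m_def)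
  \<comment> \<open>The cap \<open>1/12\<close> keeps \<open>3 * \<eta> + \<delta>\<close> below 1,
    so that \<open>g\<close> does not vanish on \<open>N\<close>. The other bound and
    \<open>\<eta> \<le> D * \<eta>\<close> keep the total displacement
    \<open>6 * D * \<eta> + 2 * D * \<delta> + \<eta>\<close> below \<open>m\<close>.\<close>
  define \<eta> where "\<eta> = min (1/12) ((m - 2 * D * \<delta>) / (8 * D))"
  have "0 < \<eta>"
    using m D\<delta> D(1) by (simp add: \<eta>_def)
  have "\<eta> \<le> (m - 2 * D * \<delta>) / (8 * D)"
    by (simp add: \<eta>_def)
  then have "8 * (D * \<eta>) \<le> m - 2 * D * \<delta>"
    using D(1) by (simp add: field_simps)
  moreover have "\<eta> \<le> D * \<eta>" "0 < D * \<eta>"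
    using D(1) \<open>0 < \<eta>\<close> by auto
  ultimately have \<eta>m: "D * (2 * (3 * \<eta> + \<delta>)) + \<eta> < m"
    by (simp add: algebra_simps)
  moreover have "0 \<le> D * (2 * (3 * \<eta> + \<delta>))"
    using D(1) \<delta>(1) \<open>0 < \<eta>\<close> by (intro mult_nonneg_nonneg) auto
  ultimately have "\<eta> < m"
    by linarith
  have \<eta>1: "3 * \<eta> + \<delta> < 1"
    using \<delta>(2) by (simp add: \<eta>_def)
  obtain g where contg: "continuous_on {y. infdist y ?\<Sigma> \<le> \<eta>} g"
    and g: "\<And>x y. \<lbrakk>x \<in> S; infdist y ?\<Sigma> \<le> \<eta>\<rbrakk> \<Longrightarrow> norm (g y - x) \<le> 2 * \<eta> + \<delta> + dist y (f x)"
    using approximate_inverse [OF S f exp, of \<eta> "2 * \<eta>"] \<open>0 < \<eta>\<close> by auto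
  define N where "N = {y. infdist y ?\<Sigma> < \<eta>}"
  \<comment> \<open>Compare with a nearest image point \<open>f x\<close>: normalising doubles the
    error \<open>3 * \<eta> + \<delta>\<close>, \<open>f\<close> multiplies it by \<open>D\<close>,
    and returning from \<open>f x\<close> to \<open>y\<close> costs less than
    \<open>\<eta>\<close>.\<close>
  have near: "g y \<noteq> 0 \<and> dist (f (sgn (g y))) y < m" if "y \<in> N" for y
  proof -
    obtain x where x: "x \<in> S" "infdist y ?\<Sigma> = dist y (f x)"
      using attain by blast
    have gx: "norm (g y - x) \<le> 3 * \<eta> + \<delta>"
      using g [OF x(1), of y] x(2) that by (simp add: N_def)
    have nx: "norm x = 1"
      using x(1) by (simp add: S_def)
    have g0: "g y \<noteq> 0"
      using gx \<eta>1 nx by auto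
    then have "sgn (g y) \<in> S"
      by (simp add: S_def norm_sgn)
    then have "dist (f (sgn (g y))) (f x) \<le> D * dist (sgn (g y)) x"
      using D(2) x(1) by (auto intro: lipschitz_onD)
    also have "\<dots> \<le> D * (2 * (3 * \<eta> + \<delta>))"
      using sgn_approximates_unit_vector [OF nx g0] gx D(1) by (intro mult_left_mono) (auto simp: dist_norm)
    finally have "dist (f (sgn (g y))) y < m"
      using dist_triangle [of "f (sgn (g y))" y "f x"] x(2) that \<eta>m by (simp add: N_def dist_commute)
    with g0 show ?thesis
      by blast
  qed
  have openN: "open N"
    unfolding N_def by (intro open_Collect_less continuous_intros)
  have \<Sigma>N: "?\<Sigma> \<subseteq> N"
    using \<open>0 < \<eta>\<close> by (auto simp: N_def)
  have H: "open (H \<union> N)" "compact (H - N)" if "H \<in> holes ?\<Sigma>" for H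
  proof -
    have "open H"
      using that open_components [OF open_Compl [OF compact_imp_closed [OF \<Sigma>(1)]]]
      by (auto simp: holes_def)
    then show "open (H \<union> N)"
      using openN by blast
    \<comment> \<open>Since \<open>N\<close> covers the frontier of the hole, removing
      \<open>N\<close> from the hole is the same as removing it from the compact closure.\<close>
    have "frontier H \<subseteq> ?\<Sigma>"
      using that frontier_of_components_closed_complement [OF compact_imp_closed [OF \<Sigma>(1)]]
      by (auto simp: holes_def)
    then have "H - N = closure H - N"
      using \<Sigma>N \<open>open H\<close> closure_subset [of H] by (auto simp: frontier_def interior_open)
    moreover have "compact (closure H - N)"
      using that openN by (intro compact_diff) (auto simp: holes_def compact_closure)
    ultimately show "compact (H - N)"
      by simp
  qed
  have notN: "c \<notin> N" if "c \<in> {a, b}" for c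
    using that \<open>\<eta> < m\<close> by (auto simp: N_def m_def)
  have sub: "A \<subseteq> - ?\<Sigma>" "B \<subseteq> - ?\<Sigma>"
    using A(1) B(1) in_components_subset by (auto simp: holes_def)
  have conth: "continuous_on N (sgn \<circ> g)"
    using near unfolding o_def
    by (intro continuous_on_sgn continuous_on_subset [OF contg]) (auto simp: N_def)
  have hS: "sgn \<circ> g \<in> N \<rightarrow> S"
    using near by (auto simp: S_def norm_sgn)
  have hom: "homotopic_with_canon (\<lambda>_. True) N (- {c}) (f \<circ> (sgn \<circ> g)) id" if c: "c \<in> {a, b}" for c
  proof (rule homotopic_with_linear)
    show "continuous_on N (f \<circ> (sgn \<circ> g))"
      using hS by (intro continuous_on_compose conth continuous_on_subset [OF f]) auto
    fix y assume y: "y \<in> N"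
    show "closed_segment ((f \<circ> (sgn \<circ> g)) y) (id y) \<subseteq> - {c}"
    proof -
      \<comment> \<open>The segment is shorter than \<open>m\<close> and starts on the image, from
        which \<open>c\<close> has distance at least \<open>m\<close>.\<close>
      have "c \<notin> closed_segment (f (sgn (g y))) y"
      proof
        assume "c \<in> closed_segment (f (sgn (g y))) y"
        then have "dist c (f (sgn (g y))) \<le> dist (f (sgn (g y))) y"
          using segment_bound(1) by (metis dist_norm dist_commute)
        moreover have "f (sgn (g y)) \<in> ?\<Sigma>"
          using funcset_mem [OF hS y] by simp
        then have "m \<le> dist c (f (sgn (g y)))"
          using c infdist_le [of "f (sgn (g y))" ?\<Sigma> c] by (auto simp: m_def min_le_iff_disj)
        ultimately show False
          using near [OF y] by simp
      qed
      then show ?thesis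
        by auto
    qed
  qed auto
  show False
  proof (rule no_factorization_through_sphere [OF dim openN _ _ H [OF A(1)] ab(1) _ H [OF B(1)] ab(2)])
    show "f \<in> sphere 0 1 \<rightarrow> - {a, b}"
      using ab sub by (auto simp: S_def)
  qed (use notN ab disj conth hS f hom in \<open>auto simp: S_def\<close>)
qed

theorem theorem2p1:
  assumes "CARD('d::finite) \<ge> 2"
  shows
    "(\<forall>(\<delta>::real) (f :: real^'d \<Rightarrow> real^'d).
        0 \<le> \<delta> \<and> \<delta> < 1/4 \<and> continuous_on (sphere 0 1) f \<and>
        (\<forall>x\<in>sphere 0 1. \<forall>y\<in>sphere 0 1. norm (f x - f y) \<ge> norm (x - y) - \<delta>)
        \<longrightarrow> (\<exists>H\<in>holes (f ` sphere 0 1). \<exists>c. cball c (1/4) \<subseteq> H))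
     \<and>
     (\<forall>(\<delta>::real) (f1 :: real^'d \<Rightarrow> real^'d) (f2 :: real^'d \<Rightarrow> real^'d).
        0 \<le> \<delta> \<and> \<delta> < 1/4 \<and>
        continuous_on (sphere 0 1) f1 \<and> continuous_on (sphere 0 1) f2 \<and>
        (\<forall>x\<in>sphere 0 1. \<forall>y\<in>sphere 0 1. norm (f1 x - f1 y) \<ge> norm (x - y) - \<delta>) \<and>
        (\<forall>x\<in>sphere 0 1. \<forall>y\<in>sphere 0 1. norm (f2 x - f2 y) \<ge> norm (x - y) - \<delta>) \<and>
        (\<forall>x\<in>sphere 0 1. norm (f1 x - f2 x) < 1/4)
        \<longrightarrow> (\<exists>H1\<in>holes (f1 ` sphere 0 1). \<exists>H2\<in>holes (f2 ` sphere 0 1). H1 \<inter> H2 \<noteq> {}))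
     \<and>
     (\<forall>(\<delta>::real) (D::real) (f :: real^'d \<Rightarrow> real^'d).
        0 \<le> \<delta> \<and> \<delta> < 1/4 \<and> continuous_on (sphere 0 1) f \<and>
        (\<forall>x\<in>sphere 0 1. \<forall>y\<in>sphere 0 1. norm (f x - f y) \<ge> norm (x - y) - \<delta>) \<and>
        D \<ge> 1 \<and> D-lipschitz_on (sphere 0 1) f
        \<longrightarrow> (\<forall>H1\<in>holes (f ` sphere 0 1). \<forall>H2\<in>holes (f ` sphere 0 1).
               (\<exists>c. cball c (4 * D * \<delta>) \<subseteq> H1) \<and> (\<exists>c. cball c (4 * D * \<delta>) \<subseteq> H2)
               \<longrightarrow> H1 = H2))"
proof (intro conjI allI impI ballI)
  have dim: "2 \<le> DIM(real^'d)"
    using assms by simp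
  fix \<delta> :: real
  {
    fix f :: "real^'d \<Rightarrow> real^'d"
    assume "0 \<le> \<delta> \<and> \<delta> < 1/4 \<and> continuous_on (sphere 0 1) f \<and>
      (\<forall>x\<in>sphere 0 1. \<forall>y\<in>sphere 0 1. norm (f x - f y) \<ge> norm (x - y) - \<delta>)"
    then show "\<exists>H\<in>holes (f ` sphere 0 1). \<exists>c. cball c (1/4) \<subseteq> H"
      by (intro hole_with_quarter_ball [OF dim, of \<delta>]) auto
  next
    fix f1 f2 :: "real^'d \<Rightarrow> real^'d"
    assume "0 \<le> \<delta> \<and> \<delta> < 1/4 \<and>
      continuous_on (sphere 0 1) f1 \<and> continuous_on (sphere 0 1) f2 \<and>
      (\<forall>x\<in>sphere 0 1. \<forall>y\<in>sphere 0 1. norm (f1 x - f1 y) \<ge> norm (x - y) - \<delta>) \<and>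
      (\<forall>x\<in>sphere 0 1. \<forall>y\<in>sphere 0 1. norm (f2 x - f2 y) \<ge> norm (x - y) - \<delta>) \<and>
      (\<forall>x\<in>sphere 0 1. norm (f1 x - f2 x) < 1/4)"
    then show "\<exists>H1\<in>holes (f1 ` sphere 0 1). \<exists>H2\<in>holes (f2 ` sphere 0 1). H1 \<inter> H2 \<noteq> {}"
      by (intro holes_of_close_maps_intersect [OF dim, of \<delta>]) auto
  next
    fix D :: real and f :: "real^'d \<Rightarrow> real^'d" and H1 H2
    assume "0 \<le> \<delta> \<and> \<delta> < 1/4 \<and> continuous_on (sphere 0 1) f \<and>
      (\<forall>x\<in>sphere 0 1. \<forall>y\<in>sphere 0 1. norm (f x - f y) \<ge> norm (x - y) - \<delta>) \<and>
      D \<ge> 1 \<and> D-lipschitz_on (sphere 0 1) f"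
      and "H1 \<in> holes (f ` sphere 0 1)" "H2 \<in> holes (f ` sphere 0 1)"
      and "(\<exists>c. cball c (4 * D * \<delta>) \<subseteq> H1) \<and> (\<exists>c. cball c (4 * D * \<delta>) \<subseteq> H2)"
    then show "H1 = H2"
      by (elim conjE exE) (rule holes_with_large_balls_eq [OF dim, of \<delta> f D], auto)
  }
qed

end
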